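(* Let $M\subset\mathbb{R}^n$ be a weak $r$-helix submanifold with respect to the directions $d_1,\dots,d_r\in\mathbb{R}^n$. Let $\alpha:I\subset\mathbb{R}\to M$ be a unit speed curve, not a straight line, with unit tangent vector field $T$, and suppose $\alpha$ is a line of curvature for a normal vector field $\xi$ of $M$ such that $\xi'$ is tangent to $M$ along $\alpha$ (i.e. $\xi'(s)=\frac{d}{ds}\xi(\alpha(s))\in T_{\alpha(s)}M$ for all $s\in I$). Then for every $j\in\{1,\dots,r\}$, $d_j\notin \mathrm{Sp}\{\xi,T\}$ along $\alpha$; that is, it is not the case that $d_j\in\mathrm{Sp}\{\xi(\alpha(s)),T(s)\}$ for all $s\in I$.
   Context: All submanifolds, curves and vector fields are smooth; $I$ is an interval; $\mathbb{R}^n$ has its Euclidean metric, with standard covariant derivative $D$; $\mathrm{Sp}$ denotes linear span. A submanifold $M\subset\mathbb{R}^n$ is a helix with respect to a unit vector $d\in\mathbb{R}^n$ if the angle $\theta$ between $d$ and $T_qM$ is the same for all $q\in M$; it is assumed that $0<\theta<\pi/2$. $M$ is a weak $r$-helix with respect to $d_1,\dots,d_r$ if these are $r$ linearly independent unit vectors and $M$ is a helix with respect to every $d_j$ (with angle $\theta_j$, $0<\theta_j<\pi/2$). For a normal field $\xi$ and a tangent vector $X$ of $M$, the shape operator $A^{\xi}(X)$ is the tangential component of $-D_X\xi$. A unit speed curve $\alpha$ in $M$ with unit tangent $T$ is a line of curvature for the normal field $\xi$ if $A^{\xi}(T)=\lambda T$ along $\alpha$ for some function $\lambda$ (a principal curvature).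 *)

theory Defs
  imports "HOL-Analysis.Analysis"
begin

text \<open>
  Smoothness on an open set of a Euclidean space: all iterated directional derivatives exist
  and are (Frechet) differentiable. The set \<open>S\<close> is meant to be open.
\<close>

primrec Ck_on :: "nat \<Rightarrow> 'a::euclidean_space set \<Rightarrow> ('a \<Rightarrow> 'b::euclidean_space) \<Rightarrow> bool" where
  "Ck_on 0 S f \<longleftrightarrow> continuous_on S f"
| "Ck_on (Suc k) S f \<longleftrightarrow>
     (\<forall>x\<in>S. f differentiable (at x)) \<and> (\<forall>v. Ck_on k S (\<lambda>x. frechet_derivative f (at x) v))"

definition smooth_on :: "'a::euclidean_space set \<Rightarrow> ('a \<Rightarrow> 'b::euclidean_space) \<Rightarrow> bool" where
  "smooth_on S f \<longleftrightarrow> (\<forall>k. Ck_on k S f)"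

text \<open>
  A smooth curve on an arbitrary interval \<open>I\<close>; \<open>D k\<close> is the \<open>k\<close>-th derivative,
  one-sided at an end point belonging to \<open>I\<close>.
\<close>

definition smooth_curve_on :: "real set \<Rightarrow> (real \<Rightarrow> 'a::euclidean_space) \<Rightarrow> bool" where
  "smooth_curve_on I \<gamma> \<longleftrightarrow>
     (\<exists>D. (\<forall>s\<in>I. D 0 s = \<gamma> s) \<and>
          (\<forall>k::nat. \<forall>s\<in>I. (D k has_vector_derivative D (Suc k) s) (at s within I)))"

text \<open>
  A \<open>k\<close>-dimensional smooth (embedded) submanifold: around each of its points some
  diffeomorphism of open sets flattens \<open>M\<close> to a \<open>k\<close>-dimensional linear subspace.
\<close>

definition submanifold :: "nat \<Rightarrow> 'a::euclidean_space set \<Rightarrow> bool" where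
  "submanifold k M \<longleftrightarrow>
     (\<forall>p\<in>M. \<exists>(U::'a set) (V::'a set) \<phi> \<psi> E.
        open U \<and> p \<in> U \<and> open V \<and> homeomorphism U V \<phi> \<psi> \<and> smooth_on U \<phi> \<and> smooth_on V \<psi> \<and>
        subspace E \<and> dim E = k \<and> \<phi> ` (U \<inter> M) = V \<inter> E)"

text \<open>The velocities at \<open>p\<close> of the smooth curves in \<open>M\<close> through \<open>p\<close>.\<close>

definition tangent_space :: "'a::euclidean_space set \<Rightarrow> 'a \<Rightarrow> 'a set" where
  "tangent_space M p =
     {v. \<exists>\<gamma> e. 0 < e \<and> smooth_curve_on {-e<..<e} \<gamma> \<and> \<gamma> ` {-e<..<e} \<subseteq> M \<and>
               \<gamma> 0 = p \<and> (\<gamma> has_vector_derivative v) (at 0)}"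

definition orth_proj :: "'a::euclidean_space set \<Rightarrow> 'a \<Rightarrow> 'a" where
  "orth_proj W x = (THE y. y \<in> W \<and> (\<forall>w\<in>W. orthogonal (x - y) w))"

text \<open>
  The angle in \<open>[0, \<pi>/2]\<close> between a nonzero vector and a subspace, i.e. between the vector and
  its orthogonal projection (\<open>\<pi>/2\<close> if that projection vanishes).
\<close>

definition subspace_angle :: "'a::euclidean_space \<Rightarrow> 'a set \<Rightarrow> real" where
  "subspace_angle x W = arccos (norm (orth_proj W x) / norm x)"

definition helix_wrt :: "'a::euclidean_space set \<Rightarrow> 'a \<Rightarrow> bool" where
  "helix_wrt M d \<longleftrightarrow> norm d = 1 \<and>
     (\<exists>\<theta>. 0 < \<theta> \<and> \<theta> < pi / 2 \<and> (\<forall>q\<in>M. subspace_angle d (tangent_space M q) = \<theta>))"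

definition weak_helix :: "nat \<Rightarrow> (nat \<Rightarrow> 'a::euclidean_space) \<Rightarrow> 'a set \<Rightarrow> bool" where
  "weak_helix r d M \<longleftrightarrow>
     inj_on d {1..r} \<and> independent (d ` {1..r}) \<and> (\<forall>j\<in>{1..r}. helix_wrt M (d j))"

text \<open>Smoothness on \<open>M\<close> means local smooth extendability to the ambient space.\<close>

definition normal_field :: "'a::euclidean_space set \<Rightarrow> ('a \<Rightarrow> 'a) \<Rightarrow> bool" where
  "normal_field M \<xi> \<longleftrightarrow>
     (\<forall>p\<in>M. \<exists>U F. open U \<and> p \<in> U \<and> smooth_on U F \<and> (\<forall>x\<in>U \<inter> M. F x = \<xi> x)) \<and>
     (\<forall>p\<in>M. \<forall>w\<in>tangent_space M p. orthogonal (\<xi> p) w)"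

text \<open>
  The derivative within \<open>M\<close> stands for the covariant derivative of the ambient space. As a linear
  map on the whole space it is not unique, but its values on vectors \<open>X\<close> tangent to \<open>M\<close> at \<open>p\<close>
  are: they are the derivatives of \<open>\<xi>\<close> along curves in \<open>M\<close> with velocity \<open>X\<close>.
\<close>

definition shape_operator ::
    "'a::euclidean_space set \<Rightarrow> ('a \<Rightarrow> 'a) \<Rightarrow> 'a \<Rightarrow> 'a \<Rightarrow> 'a" where
  "shape_operator M \<xi> p X =
     orth_proj (tangent_space M p) (- frechet_derivative \<xi> (at p within M) X)"

definition unit_tangent :: "real set \<Rightarrow> (real \<Rightarrow> 'a::euclidean_space) \<Rightarrow> real \<Rightarrow> 'a" where
  "unit_tangent I \<alpha> s = vector_derivative \<alpha> (at s within I)"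

definition unit_speed_curve_in ::
    "'a::euclidean_space set \<Rightarrow> real set \<Rightarrow> (real \<Rightarrow> 'a) \<Rightarrow> bool" where
  "unit_speed_curve_in M I \<alpha> \<longleftrightarrow>
     is_interval I \<and> smooth_curve_on I \<alpha> \<and> \<alpha> ` I \<subseteq> M \<and> (\<forall>s\<in>I. norm (unit_tangent I \<alpha> s) = 1)"

definition line_of_curvature ::
    "'a::euclidean_space set \<Rightarrow> ('a \<Rightarrow> 'a) \<Rightarrow> real set \<Rightarrow> (real \<Rightarrow> 'a) \<Rightarrow> bool" where
  "line_of_curvature M \<xi> I \<alpha> \<longleftrightarrow>
     (\<exists>\<kappa>::real \<Rightarrow> real. \<forall>s\<in>I.
        shape_operator M \<xi> (\<alpha> s) (unit_tangent I \<alpha> s) = \<kappa> s *\<^sub>R unit_tangent I \<alpha> s)"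

end

theory Submission
  imports Defs
begin

text \<open>
  Suppose that one of the directions, \<open>d\<close>, can be written as \<open>d = a \<xi> + b T\<close> along \<open>\<alpha>\<close>. As \<open>\<xi>\<close> is
  normal and \<open>T\<close> is a unit tangent vector, \<open>b T\<close> is the projection of \<open>d\<close> to the tangent space, so \<open>b = \<langle>d, T\<rangle>\<close> and the helix condition says \<open>\<bar>b\<bar> = cos \<theta>\<close> with
  \<open>0 < cos \<theta> < 1\<close>. Hence \<open>a\<close>, \<open>b\<close> and \<open>\<xi>\<close> never vanish along \<open>\<alpha>\<close>, and \<open>b\<close> has zero derivative:
  \<open>\<langle>d, T'\<rangle> = 0\<close>. Since \<open>\<langle>T, T'\<rangle> = 0\<close> as well, \<open>\<langle>\<xi>, T'\<rangle> = 0\<close>, and differentiating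
  \<open>\<langle>\<xi>, T\<rangle> = 0\<close> gives \<open>\<langle>\<xi>', T\<rangle> = 0\<close>. On the other hand \<open>\<xi>'\<close> is tangent to \<open>M\<close>, so \<open>- \<xi>'\<close> is its
  own tangential part, which is a multiple of \<open>T\<close> because \<open>\<alpha>\<close> is a line of curvature. Therefore
  \<open>\<xi>' = 0\<close>, and differentiating the expansion of \<open>d\<close> leaves \<open>b T' = 0\<close>. So \<open>T\<close> is constant and
  \<open>\<alpha>\<close> is a straight line.

  The tangent vectors of \<open>M\<close> are velocities of curves in \<open>M\<close> that exist on both sides of their
  base point, and \<open>\<alpha>\<close> itself is such a curve only over the interior of \<open>I\<close>. So the argument takes
  place there (\<open>unit_field_derivative_zero\<close>, with \<open>helix_tangential_component\<close> providing
  \<open>\<bar>b\<bar> = cos \<theta>\<close>), and the end points are reached by continuity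
  (\<open>collinear_if_interior_acceleration_zero\<close>). Projections to the tangent space are found by
  exhibiting them: any vector with the defining property is the projection (\<open>orth_proj_eqI\<close>), and
  multiples of tangent vectors are tangent (\<open>tangent_space_scaleR\<close>).
\<close>

text \<open>
  The projection is unique for an arbitrary set \<open>W\<close>: if \<open>y\<close> and \<open>z\<close> both qualify, then \<open>y - z\<close>
  is orthogonal to the members \<open>y\<close> and \<open>z\<close> of \<open>W\<close>, hence to itself.
\<close>

lemma orth_proj_eqI:
  assumes "y \<in> W" and "\<And>w. w \<in> W \<Longrightarrow> orthogonal (x - y) w"
  shows "orth_proj W x = y"
  unfolding orth_proj_def
proof (rule the_equality)
  show "y \<in> W \<and> (\<forall>w\<in>W. orthogonal (x - y) w)"
    using assms by blast
next
  fix z assume z: "z \<in> W \<and> (\<forall>w\<in>W. orthogonal (x - z) w)"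
  have "(x - y) \<bullet> y = 0" "(x - y) \<bullet> z = 0" "(x - z) \<bullet> y = 0" "(x - z) \<bullet> z = 0"
    using assms z by (auto simp: orthogonal_def)
  then have "(z - y) \<bullet> (z - y) = 0"
    by (simp add: inner_diff_left inner_diff_right inner_commute)
  then show "z = y" by simp
qed

lemma smooth_curve_on_affine:
  assumes "smooth_curve_on I \<gamma>" and "\<And>t. t \<in> J \<Longrightarrow> s + c * t \<in> I"
  shows "smooth_curve_on J (\<lambda>t. \<gamma> (s + c * t))"
proof -
  obtain D where D0: "\<And>t. t \<in> I \<Longrightarrow> D 0 t = \<gamma> t"
    and D: "\<And>k t. t \<in> I \<Longrightarrow> (D k has_vector_derivative D (Suc k) t) (at t within I)"
    using assms(1) unfolding smooth_curve_on_def by blast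
  let ?h = "\<lambda>t. s + c * t"
  have "((\<lambda>t. c ^ k *\<^sub>R D k (?h t)) has_vector_derivative
      c ^ Suc k *\<^sub>R D (Suc k) (?h t)) (at t within J)" if "t \<in> J" for k t
  proof -
    have "(?h has_vector_derivative c) (at t within J)"
      by (auto intro!: derivative_eq_intros)
    moreover have "(D k has_vector_derivative D (Suc k) (?h t)) (at (?h t) within ?h ` J)"
      by (rule has_vector_derivative_within_subset[OF D[OF assms(2)[OF that]]]) (use assms(2) in blast)
    ultimately have "(D k \<circ> ?h has_vector_derivative c *\<^sub>R D (Suc k) (?h t)) (at t within J)"
      by (rule vector_diff_chain_within)
    from has_vector_derivative_scaleR[OF DERIV_const[of "c ^ k"] this]
    show ?thesis by (simp add: o_def mult.commute)
  qed
  then show ?thesis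
    unfolding smooth_curve_on_def
    by (intro exI[of _ "\<lambda>k t. c ^ k *\<^sub>R D k (?h t)"]) (simp add: D0 assms(2))
qed

text \<open>A curve run through at \<open>c\<close> times the speed has \<open>c\<close> times the velocity.\<close>

lemma tangent_space_scaleR:
  assumes "v \<in> tangent_space M p"
  shows "c *\<^sub>R v \<in> tangent_space M p"
proof -
  obtain \<gamma> e where \<gamma>: "0 < e" "smooth_curve_on {-e<..<e} \<gamma>" "\<gamma> ` {-e<..<e} \<subseteq> M" "\<gamma> 0 = p"
      "(\<gamma> has_vector_derivative v) (at 0)"
    using assms unfolding tangent_space_def by blast
  define e' where "e' = e / (\<bar>c\<bar> + 1)"
  have e': "0 < e'" using \<gamma>(1) by (simp add: e'_def)
  have mem: "0 + c * t \<in> {-e<..<e}" if "t \<in> {-e'<..<e'}" for t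
  proof -
    have "\<bar>c * t\<bar> \<le> (\<bar>c\<bar> + 1) * \<bar>t\<bar>" by (simp add: abs_mult mult_right_mono)
    also have "\<dots> < (\<bar>c\<bar> + 1) * e'" using that by (intro mult_strict_left_mono) auto
    also have "\<dots> = e" by (simp add: e'_def)
    finally show ?thesis by auto
  qed
  have smooth: "smooth_curve_on {-e'<..<e'} (\<lambda>t. \<gamma> (0 + c * t))"
    by (rule smooth_curve_on_affine[OF \<gamma>(2) mem])
  have lin: "((\<lambda>t. 0 + c * t) has_vector_derivative c) (at 0)"
    by (auto intro!: derivative_eq_intros)
  have "(\<gamma> \<circ> (\<lambda>t. 0 + c * t) has_vector_derivative c *\<^sub>R v) (at 0)"
    by (rule vector_diff_chain_at[OF lin]) (simp add: \<gamma>(5))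
  then show ?thesis
    unfolding tangent_space_def using e' smooth mem \<gamma>(3,4)
    by (intro CollectI exI[of _ "\<lambda>t. \<gamma> (0 + c * t)"] exI[of _ e']) (auto simp: o_def)
qed

lemma velocity_in_tangent_space:
  assumes "smooth_curve_on I \<alpha>" and "\<alpha> ` I \<subseteq> M" and "s \<in> interior I"
    and "(\<alpha> has_vector_derivative v) (at s)"
  shows "v \<in> tangent_space M (\<alpha> s)"
proof -
  obtain e where e: "0 < e" "ball s e \<subseteq> I"
    using assms(3) by (meson mem_interior)
  have mem: "s + 1 * t \<in> I" if "t \<in> {-e<..<e}" for t
    using that e(2) by (auto simp: subset_iff dist_real_def)
  have smooth: "smooth_curve_on {-e<..<e} (\<lambda>t. \<alpha> (s + 1 * t))"
    by (rule smooth_curve_on_affine[OF assms(1) mem])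
  have lin: "((\<lambda>t. s + 1 * t) has_vector_derivative 1) (at 0)"
    by (auto intro!: derivative_eq_intros)
  have "(\<alpha> \<circ> (\<lambda>t. s + 1 * t) has_vector_derivative 1 *\<^sub>R v) (at 0)"
    by (rule vector_diff_chain_at[OF lin]) (simp add: assms(4))
  then show ?thesis
    unfolding tangent_space_def using e(1) smooth mem assms(2)
    by (intro CollectI exI[of _ "\<lambda>t. \<alpha> (s + 1 * t)"] exI[of _ e]) (auto simp: o_def)
qed

text \<open>
  The derivative of \<open>\<xi>\<close> within \<open>M\<close> is a choice among several linear maps. Along a curve in \<open>M\<close>
  the chain rule within \<open>M\<close> holds for whichever map is chosen.
\<close>

lemma normal_field_along_curve:
  fixes \<alpha> :: "real \<Rightarrow> 'a::euclidean_space"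
  assumes "normal_field M \<xi>" and "\<alpha> ` I \<subseteq> M" and "s \<in> I"
    and "(\<alpha> has_vector_derivative v) (at s within I)"
  shows "(\<xi> \<circ> \<alpha> has_vector_derivative frechet_derivative \<xi> (at (\<alpha> s) within M) v) (at s within I)"
proof -
  have p: "\<alpha> s \<in> M" using assms by blast
  then obtain U F where U: "open U" "\<alpha> s \<in> U" "smooth_on U F" "\<And>x. x \<in> U \<inter> M \<Longrightarrow> F x = \<xi> x"
    using assms(1) unfolding normal_field_def by metis
  obtain e where e: "0 < e" "ball (\<alpha> s) e \<subseteq> U"
    using U(1,2) open_contains_ball by blast
  have "Ck_on (Suc 0) U F" using U(3) unfolding smooth_on_def by blast
  then have "F differentiable (at (\<alpha> s))" using U(2) by simp
  then obtain F' where "(F has_derivative F') (at (\<alpha> s) within M)"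
    unfolding differentiable_def using has_derivative_at_withinI by blast
  then have "(\<xi> has_derivative F') (at (\<alpha> s) within M)"
    by (rule has_derivative_transform_within[OF _ e(1) p]) (use U(4) e(2) in \<open>auto simp: subset_iff dist_commute\<close>)
  then have "(\<xi> has_derivative frechet_derivative \<xi> (at (\<alpha> s) within M)) (at (\<alpha> s) within M)"
    using frechet_derivative_works differentiableI by blast
  then have "(\<xi> has_derivative frechet_derivative \<xi> (at (\<alpha> s) within M)) (at (\<alpha> s) within \<alpha> ` I)"
    using assms(2) has_derivative_subset by blast
  then show ?thesis
    by (rule vector_derivative_diff_chain_within[OF assms(4)])
qed

text \<open>
  The tangential part of \<open>d = a \<xi> + b T\<close> is \<open>b T\<close>, whose length is \<open>\<bar>d \<bullet> T\<bar>\<close>; the helix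
  condition makes it the cosine of an angle that is the same at all points of \<open>M\<close>.
\<close>

lemma helix_tangential_component:
  assumes "helix_wrt M d"
  obtains c where "0 < c" "c < 1"
    "\<And>p n T. \<lbrakk>p \<in> M; T \<in> tangent_space M p; norm T = 1; \<forall>w\<in>tangent_space M p. orthogonal n w;
       d \<in> span {n, T}\<rbrakk> \<Longrightarrow> \<bar>d \<bullet> T\<bar> = c"
proof -
  obtain \<theta> where \<theta>: "0 < \<theta>" "\<theta> < pi / 2" and nd: "norm d = 1"
    and angle: "\<And>q. q \<in> M \<Longrightarrow> subspace_angle d (tangent_space M q) = \<theta>"
    using assms unfolding helix_wrt_def by blast
  have c: "0 < cos \<theta>" "cos \<theta> < 1"
    using \<theta> cos_monotone_0_pi[of 0 \<theta>] by (auto intro!: cos_gt_zero_pi)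
  have "\<bar>d \<bullet> T\<bar> = cos \<theta>"
    if p: "p \<in> M" and T: "T \<in> tangent_space M p" "norm T = 1"
      and n: "\<forall>w\<in>tangent_space M p. orthogonal n w" and sp: "d \<in> span {n, T}" for p n T
  proof -
    obtain a b where d: "d = a *\<^sub>R n + b *\<^sub>R T"
      using sp by (auto simp: span_insert span_singleton algebra_simps)
    have "n \<bullet> T = 0" using n T(1) by (auto simp: orthogonal_def)
    moreover have "T \<bullet> T = 1" using T(2) by (simp add: dot_square_norm)
    ultimately have b: "d \<bullet> T = b" by (simp add: d inner_add_left)
    have "orth_proj (tangent_space M p) d = b *\<^sub>R T"
      using n by (intro orth_proj_eqI tangent_space_scaleR T(1)) (simp add: d orthogonal_def)
    then have "arccos \<bar>b\<bar> = \<theta>"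
      using angle[OF p] nd T(2) by (simp add: subspace_angle_def)
    moreover have "\<bar>b\<bar> \<le> 1"
      using Cauchy_Schwarz_ineq2[of d T] b nd T(2) by simp
    ultimately show ?thesis using b cos_arccos_abs[of "\<bar>b\<bar>"] by auto
  qed
  with c that show ?thesis by blast
qed

text \<open>
  The metric part of the argument, free of \<open>M\<close>; here \<open>n\<close> stands for \<open>\<xi> \<circ> \<alpha>\<close> and \<open>\<mu>\<close> for
  \<open>- \<kappa>\<close>. The derivative of \<open>T\<close> is orthogonal to \<open>T\<close>, and to \<open>d\<close> because of the fixed angle
  between them, so it is orthogonal to \<open>n\<close>, too. This forces \<open>\<mu> = 0\<close>: then \<open>n\<close> is stationary at
  \<open>s\<close>, and \<open>T\<close> as well, being the only part of the constant \<open>d\<close> that could still vary.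
\<close>

lemma unit_field_derivative_zero:
  fixes n T :: "real \<Rightarrow> 'a::euclidean_space"
  assumes J: "open J" "s \<in> J"
    and T': "(T has_vector_derivative T') (at s)"
    and n': "(n has_vector_derivative \<mu> *\<^sub>R T s) (at s)"
    and unit: "\<And>t. t \<in> J \<Longrightarrow> norm (T t) = 1"
    and orth: "\<And>t. t \<in> J \<Longrightarrow> n t \<bullet> T t = 0"
    and d: "norm d = 1" "\<And>t. t \<in> J \<Longrightarrow> d \<in> span {n t, T t}"
    and c: "0 < c" "c < 1" "\<And>t. t \<in> J \<Longrightarrow> \<bar>d \<bullet> T t\<bar> = c"
  shows "T' = 0"
proof -
  \<comment> \<open>This turns each identity along the curve below into one between derivatives at \<open>s\<close>.\<close>
  have diff_eq: "f' = g'"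
    if "(f has_vector_derivative f') (at s)" "(g has_vector_derivative g') (at s)"
      "\<And>t. t \<in> J \<Longrightarrow> f t = g t" for f g :: "real \<Rightarrow> 'b::real_normed_vector" and f' g'
    using has_vector_derivative_transform_within_open[OF that(1) J that(3)] that(2)
    by (rule vector_derivative_unique_at)
  have TT: "T t \<bullet> T t = 1" if "t \<in> J" for t
    using unit[OF that] by (simp add: dot_square_norm)
  have inner': "((\<lambda>t. f t \<bullet> g t) has_vector_derivative (f s \<bullet> g' + f' \<bullet> g s)) (at s)"
    if "(f has_vector_derivative f') (at s)" "(g has_vector_derivative g') (at s)"
    for f g :: "real \<Rightarrow> 'a" and f' g'
    by (rule bounded_bilinear.has_vector_derivative[OF bounded_bilinear_inner that])
  have TT': "T s \<bullet> T' = 0"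
    using diff_eq[OF inner'[OF T' T'] has_vector_derivative_const[of 1] TT]
    by (simp add: inner_commute)
  have dT: "((\<lambda>t. d \<bullet> T t) has_vector_derivative d \<bullet> T') (at s)"
    using inner'[OF has_vector_derivative_const T'] by simp
  have "(d \<bullet> T t) * (d \<bullet> T t) = c * c" if "t \<in> J" for t
    using c(3)[OF that] by (metis abs_mult_self_eq)
  from diff_eq[OF has_vector_derivative_mult[OF dT dT] has_vector_derivative_const this]
  have dT': "d \<bullet> T' = 0"
    using c(1) c(3)[OF J(2)] by auto
  have expand: "\<exists>a. d = a *\<^sub>R n t + (d \<bullet> T t) *\<^sub>R T t" if t: "t \<in> J" for t
  proof -
    obtain a b where ab: "d = a *\<^sub>R n t + b *\<^sub>R T t"
      using d(2)[OF t] by (auto simp: span_insert span_singleton algebra_simps)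
    have "d \<bullet> T t = b" by (subst ab) (simp add: inner_add_left orth[OF t] TT[OF t])
    with ab show ?thesis by metis
  qed
  obtain a where a: "d = a *\<^sub>R n s + (d \<bullet> T s) *\<^sub>R T s"
    using expand[OF J(2)] by blast
  \<comment> \<open>Otherwise \<open>d\<close> would be a multiple of \<open>T s\<close>, which makes \<open>c = 1\<close>.\<close>
  have an: "a \<noteq> 0 \<and> n s \<noteq> 0"
  proof (rule ccontr)
    assume "\<not> ?thesis"
    then have "d = (d \<bullet> T s) *\<^sub>R T s" using a by auto
    then have "norm d = \<bar>d \<bullet> T s\<bar> * norm (T s)" by (metis norm_scaleR)
    then show False using c(2) c(3)[OF J(2)] d(1) unit[OF J(2)] by simp
  qed
  have "a * (n s \<bullet> T') = 0"
    using arg_cong[OF a, of "\<lambda>x. x \<bullet> T'"] by (simp add: inner_add_left dT' TT')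
  then have "n s \<bullet> T' = 0" using an by simp
  then have "\<mu> = 0"
    using diff_eq[OF inner'[OF n' T'] has_vector_derivative_const[of 0] orth] TT[OF J(2)] by simp
  then have n'0: "(n has_vector_derivative 0) (at s)" using n' by simp
  \<comment> \<open>The expansion of \<open>d\<close>, multiplied by \<open>n \<bullet> n\<close> in order to avoid quotients.\<close>
  have identity: "(n t \<bullet> n t) *\<^sub>R d
      = (d \<bullet> n t) *\<^sub>R n t + (n t \<bullet> n t) *\<^sub>R (d \<bullet> T t) *\<^sub>R T t" if t: "t \<in> J" for t
  proof -
    obtain a where a: "d = a *\<^sub>R n t + (d \<bullet> T t) *\<^sub>R T t"
      using expand[OF t] by blast
    then have "d \<bullet> n t = a * (n t \<bullet> n t)"
      using orth[OF t] by (metis add.right_neutral inner_add_left inner_commute inner_scaleR_left mult_zero_right)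
    then have "(d \<bullet> n t) *\<^sub>R n t + (n t \<bullet> n t) *\<^sub>R (d \<bullet> T t) *\<^sub>R T t
        = (n t \<bullet> n t) *\<^sub>R (a *\<^sub>R n t + (d \<bullet> T t) *\<^sub>R T t)"
      by (simp add: scaleR_add_right mult.commute)
    then show ?thesis using a by simp
  qed
  have scale': "((\<lambda>t. f t *\<^sub>R g t) has_vector_derivative (f s *\<^sub>R g' + f' *\<^sub>R g s)) (at s)"
    if "(f has_vector_derivative f') (at s)" "(g has_vector_derivative g') (at s)"
    for f :: "real \<Rightarrow> real" and g :: "real \<Rightarrow> 'a" and f' g'
    by (rule bounded_bilinear.has_vector_derivative[OF bounded_bilinear_scaleR that])
  have nn: "((\<lambda>t. n t \<bullet> n t) has_vector_derivative 0) (at s)"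
    and dn: "((\<lambda>t. d \<bullet> n t) has_vector_derivative 0) (at s)"
    using inner'[OF n'0 n'0] inner'[OF has_vector_derivative_const[of d] n'0] by simp_all
  have "(n s \<bullet> n s) *\<^sub>R (d \<bullet> T s) *\<^sub>R T' = 0"
    using diff_eq[OF scale'[OF nn has_vector_derivative_const[of d]]
        has_vector_derivative_add[OF scale'[OF dn n'0] scale'[OF nn scale'[OF dT T']]] identity] dT'
    by simp
  then show ?thesis using an c(1) c(3)[OF J(2)] by auto
qed

text \<open>
  On the interior \<open>\<alpha>\<close> is affine. A nondegenerate interval lies in the closure of its interior, and
  the points where the continuous \<open>\<alpha>\<close> agrees with an affine map form a relatively closed set. A
  degenerate interval has at most one point.
\<close>

lemma collinear_if_interior_acceleration_zero:
  fixes \<alpha> :: "real \<Rightarrow> 'a::euclidean_space"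
  assumes I: "is_interval I" and cont: "continuous_on I \<alpha>"
    and \<alpha>': "\<And>s. s \<in> interior I \<Longrightarrow> (\<alpha> has_vector_derivative T s) (at s)"
    and T': "\<And>s. s \<in> interior I \<Longrightarrow> (T has_vector_derivative 0) (at s)"
  shows "collinear (\<alpha> ` I)"
proof (cases "interior I = {}")
  case True
  have "a = b" if "a \<in> I" "b \<in> I" for a b
  proof (rule ccontr)
    assume "a \<noteq> b"
    have "{min a b<..<max a b} \<subseteq> I"
    proof
      fix t assume "t \<in> {min a b<..<max a b}"
      then have "a \<le> t \<and> t \<le> b \<or> b \<le> t \<and> t \<le> a" by auto
      then show "t \<in> I" using I that unfolding is_interval_1 by blast
    qed
    then have "{min a b<..<max a b} \<subseteq> interior I"
      by (simp add: interior_maximal)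
    with True show False using \<open>a \<noteq> b\<close> by (auto simp: min_def max_def split: if_splits)
  qed
  then obtain a where "I \<subseteq> {a}" by blast
  then have "\<alpha> ` I \<subseteq> {\<alpha> a}" by blast
  then show ?thesis by (rule collinear_subset[OF collinear_sing])
next
  case False
  have conv: "convex I" "convex (interior I)"
    using I by (simp_all add: is_interval_convex convex_interior)
  have const: "\<exists>v. \<forall>t\<in>interior I. f t = v"
    if "\<And>s. s \<in> interior I \<Longrightarrow> (f has_vector_derivative 0) (at s)" for f :: "real \<Rightarrow> 'a"
    by (rule has_vector_derivative_zero_constant[OF conv(2) has_vector_derivative_at_within[OF that]])
      blast+
  obtain v where v: "\<And>t. t \<in> interior I \<Longrightarrow> T t = v"
    using const[OF T'] by blast
  have "((\<lambda>t. \<alpha> t - t *\<^sub>R v) has_vector_derivative 0) (at s)" if "s \<in> interior I" for s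
    using \<alpha>'[OF that] v[OF that] by (auto intro!: derivative_eq_intros)
  then obtain u where u: "\<And>t. t \<in> interior I \<Longrightarrow> \<alpha> t - t *\<^sub>R v = u"
    using const[of "\<lambda>t. \<alpha> t - t *\<^sub>R v"] by blast
  have "closedin (top_of_set I) {t \<in> I. \<alpha> t - t *\<^sub>R v = u}"
    by (intro continuous_closedin_preimage_constant continuous_intros cont)
  then obtain C where C: "closed C" "{t \<in> I. \<alpha> t - t *\<^sub>R v = u} = I \<inter> C"
    by (auto simp: closedin_closed)
  have "interior I \<subseteq> C" using u C(2) interior_subset by blast
  then have "closure (interior I) \<subseteq> C" using C(1) by (rule closure_minimal)
  then have "I \<subseteq> C"
    using convex_closure_interior[OF conv(1) False] closure_subset by blast
  then have eq: "\<alpha> t = u + t *\<^sub>R v" if "t \<in> I" for t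
    using C(2) that by (auto simp: algebra_simps)
  show ?thesis
    unfolding collinear_def
  proof (rule exI[of _ v], intro ballI)
    fix x y assume "x \<in> \<alpha> ` I" "y \<in> \<alpha> ` I"
    then obtain s t where "x = u + s *\<^sub>R v" "y = u + t *\<^sub>R v" using eq by auto
    then show "\<exists>c. x - y = c *\<^sub>R v" by (intro exI[of _ "s - t"]) (simp add: algebra_simps)
  qed
qed

theorem theorem3p6:
  fixes M :: "(real ^ 'n) set" and k r :: nat and d :: "nat \<Rightarrow> real ^ 'n"
    and I :: "real set" and \<alpha> :: "real \<Rightarrow> real ^ 'n" and \<xi> :: "real ^ 'n \<Rightarrow> real ^ 'n"
  assumes "submanifold k M"
    and "weak_helix r d M"
    and "unit_speed_curve_in M I \<alpha>"
    and "\<not> collinear (\<alpha> ` I)"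
    and "normal_field M \<xi>"
    and "line_of_curvature M \<xi> I \<alpha>"
    and "\<forall>s\<in>I. vector_derivative (\<xi> \<circ> \<alpha>) (at s within I) \<in> tangent_space M (\<alpha> s)"
  shows "\<forall>j\<in>{1..r}. \<not> (\<forall>s\<in>I. d j \<in> span {\<xi> (\<alpha> s), unit_tangent I \<alpha> s})"
proof (intro ballI notI)
  fix j assume j: "j \<in> {1..r}" and sp: "\<forall>s\<in>I. d j \<in> span {\<xi> (\<alpha> s), unit_tangent I \<alpha> s}"
  let ?J = "interior I" and ?T = "unit_tangent I \<alpha>"
  have helix: "helix_wrt M (d j)" using assms(2) j by (auto simp: weak_helix_def)
  then have nd: "norm (d j) = 1" by (simp add: helix_wrt_def)
  have I: "is_interval I" and sm: "smooth_curve_on I \<alpha>" and sub: "\<alpha> ` I \<subseteq> M"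
    and unit: "\<And>s. s \<in> I \<Longrightarrow> norm (?T s) = 1"
    using assms(3) by (auto simp: unit_speed_curve_in_def)
  have JI: "s \<in> I" if "s \<in> ?J" for s using that interior_subset by blast
  have normal: "\<And>p w. p \<in> M \<Longrightarrow> w \<in> tangent_space M p \<Longrightarrow> orthogonal (\<xi> p) w"
    using assms(5) by (auto simp: normal_field_def)
  obtain \<kappa> where \<kappa>: "\<And>s. s \<in> I \<Longrightarrow> shape_operator M \<xi> (\<alpha> s) (?T s) = \<kappa> s *\<^sub>R ?T s"
    using assms(6) by (auto simp: line_of_curvature_def)
  obtain D where D0: "\<And>s. s \<in> I \<Longrightarrow> D 0 s = \<alpha> s"
    and D: "\<And>k s. s \<in> I \<Longrightarrow> (D k has_vector_derivative D (Suc k) s) (at s within I)"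
    using sm unfolding smooth_curve_on_def by blast
  have \<alpha>'I: "(\<alpha> has_vector_derivative D 1 s) (at s within I)" if "s \<in> I" for s
    using has_vector_derivative_transform[OF that _ D[OF that, of 0], of \<alpha>] D0 by simp
  have DT: "D 1 s = ?T s" if "s \<in> ?J" for s
    unfolding unit_tangent_def at_within_interior[OF that]
    by (rule vector_derivative_at[symmetric])
      (use \<alpha>'I[OF JI[OF that]] in \<open>simp add: at_within_interior[OF that]\<close>)
  have \<alpha>': "(\<alpha> has_vector_derivative ?T s) (at s)" if "s \<in> ?J" for s
    using \<alpha>'I[OF JI[OF that]] DT[OF that] by (simp add: at_within_interior[OF that])
  have T': "(?T has_vector_derivative D 2 s) (at s)" if s: "s \<in> ?J" for s
  proof -
    have "(D 1 has_vector_derivative D 2 s) (at s)"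
      using D[OF JI[OF s], of 1] by (simp add: at_within_interior[OF s] numeral_2_eq_2)
    then show ?thesis
      by (rule has_vector_derivative_transform_within_open[OF _ open_interior s DT])
  qed
  have Ttan: "?T s \<in> tangent_space M (\<alpha> s)" if "s \<in> ?J" for s
    by (rule velocity_in_tangent_space[OF sm sub that \<alpha>'[OF that]])
  have orth: "\<xi> (\<alpha> s) \<bullet> ?T s = 0" if "s \<in> ?J" for s
    using normal[OF _ Ttan[OF that]] sub JI[OF that] by (auto simp: orthogonal_def)
  have \<xi>': "(\<xi> \<circ> \<alpha> has_vector_derivative (- \<kappa> s) *\<^sub>R ?T s) (at s)" if s: "s \<in> ?J" for s
  proof -
    let ?x = "frechet_derivative \<xi> (at (\<alpha> s) within M) (?T s)"
    have "(\<xi> \<circ> \<alpha> has_vector_derivative ?x) (at s within I)"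
      using normal_field_along_curve[OF assms(5) sub JI[OF s]] \<alpha>'I[OF JI[OF s]] DT[OF s] by simp
    then have x': "(\<xi> \<circ> \<alpha> has_vector_derivative ?x) (at s)"
      by (simp add: at_within_interior[OF s])
    then have "?x \<in> tangent_space M (\<alpha> s)"
      using assms(7)[rule_format, OF JI[OF s]]
      by (simp add: at_within_interior[OF s] vector_derivative_at)
    \<comment> \<open>Being tangent, \<open>- \<xi>'\<close> is its own tangential part.\<close>
    from tangent_space_scaleR[OF this, of "-1"]
    have "shape_operator M \<xi> (\<alpha> s) (?T s) = - ?x"
      unfolding shape_operator_def by (intro orth_proj_eqI) (simp_all add: orthogonal_def)
    with \<kappa>[OF JI[OF s]] have "?x = (- \<kappa> s) *\<^sub>R ?T s"
      by (metis minus_minus scaleR_minus_left)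
    with x' show ?thesis by simp
  qed
  obtain c where c: "0 < c" "c < 1" and
    comp: "\<And>p n T. \<lbrakk>p \<in> M; T \<in> tangent_space M p; norm T = 1;
      \<forall>w\<in>tangent_space M p. orthogonal n w; d j \<in> span {n, T}\<rbrakk> \<Longrightarrow> \<bar>d j \<bullet> T\<bar> = c"
    using helix_tangential_component[OF helix] by metis
  have dT: "\<bar>d j \<bullet> ?T s\<bar> = c" if s: "s \<in> ?J" for s
  proof (rule comp[OF _ Ttan[OF s] unit[OF JI[OF s]]])
    show "\<alpha> s \<in> M" using sub JI[OF s] by blast
    then show "\<forall>w\<in>tangent_space M (\<alpha> s). orthogonal (\<xi> (\<alpha> s)) w" using normal by blast
    show "d j \<in> span {\<xi> (\<alpha> s), ?T s}" using sp JI[OF s] by blast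
  qed
  have "D 2 s = 0" if s: "s \<in> ?J" for s
    by (rule unit_field_derivative_zero[OF open_interior s T'[OF s] \<xi>'[OF s] _ _ nd _ c dT])
      (use unit orth sp JI in auto)
  then have "(?T has_vector_derivative 0) (at s)" if "s \<in> ?J" for s
    using T'[OF that] that by simp
  moreover have "continuous_on I \<alpha>"
    using \<alpha>'I by (auto simp: continuous_on_eq_continuous_within intro: has_vector_derivative_continuous)
  ultimately have "collinear (\<alpha> ` I)"
    using collinear_if_interior_acceleration_zero[OF I _ \<alpha>'] by blast
  with assms(4) show False by contradiction
qed

end
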